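(* Let $M$ be an $m$-dimensional closed manifold $(m\geq 1)$, and let $i : M\rightarrow \mathbb{R}^{m+1}$ be an embedding. Then there exist $p_1,\ldots,p_{m+1}\in i(M)$ such that $D_{(p_1,\ldots,p_{m+1})}\circ i : M\rightarrow \mathbb{R}^{m+1}$ is an embedding.
   Context: All manifolds and mappings are of class $C^\infty$. A closed manifold is a compact manifold without boundary. $d(x,y)=\sqrt{\sum_{j=1}^n(x_j-y_j)^2}$ is the Euclidean distance on $\mathbb{R}^n$. For points $p_1,\ldots,p_\ell\in\mathbb{R}^n$ ($\ell\ge1$), the distance-squared mapping $D_{(p_1,\ldots,p_\ell)}:\mathbb{R}^n\to\mathbb{R}^\ell$ is defined by $D_{(p_1,\ldots,p_\ell)}(x)=(d^2(p_1,x),\ldots,d^2(p_\ell,x))$, where $d^2(p,x)=d(p,x)^2$. Here it is used with $n=\ell=m+1$. *)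

theory Defs
  imports "HOL-Analysis.Analysis"
begin

text \<open>
  \<open>Ck_on k S f\<close>: \<open>f\<close> is of class \<open>C\<^sup>k\<close> on \<open>S\<close>, by iterating directional derivatives.
  Derivatives are full (two-sided) ones, so this is meant for open \<open>S\<close> only, which is
  the only way it is used below.
\<close>

primrec Ck_on ::
  "nat \<Rightarrow> 'a::real_normed_vector set \<Rightarrow> ('a \<Rightarrow> 'b::real_normed_vector) \<Rightarrow> bool" where
  "Ck_on 0 S f \<longleftrightarrow> continuous_on S f"
| "Ck_on (Suc k) S f \<longleftrightarrow>
     (\<forall>x\<in>S. f differentiable (at x)) \<and>
     (\<forall>v. Ck_on k S (\<lambda>x. frechet_derivative f (at x) v))"

definition smooth_on ::
  "'a::real_normed_vector set \<Rightarrow> ('a \<Rightarrow> 'b::real_normed_vector) \<Rightarrow> bool" where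
  "smooth_on S f \<longleftrightarrow> (\<forall>k. Ck_on k S f)"

text \<open>
  A chart is a pair of a domain \<open>U\<close> and a coordinate map \<open>\<phi>\<close>, of which only the values on
  \<open>U\<close> matter.  All coordinate images are open in \<open>\<real>\<^sup>m\<close>, so the manifolds have no boundary.
\<close>

type_synonym ('a, 'm) chart = "'a set \<times> ('a \<Rightarrow> real ^ 'm)"

definition is_chart :: "'a topology \<Rightarrow> ('a, 'm::finite) chart \<Rightarrow> bool" where
  "is_chart X = (\<lambda>(U, \<phi>). openin X U \<and> open (\<phi> ` U) \<and>
     homeomorphic_map (subtopology X U) (top_of_set (\<phi> ` U)) \<phi>)"

definition compatible_charts :: "('a, 'm::finite) chart \<Rightarrow> ('a, 'm) chart \<Rightarrow> bool" where
  "compatible_charts = (\<lambda>(U, \<phi>) (V, \<psi>). smooth_on (\<phi> ` (U \<inter> V)) (\<psi> \<circ> inv_into U \<phi>))"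

text \<open>
  The atlas \<open>\<A>\<close> need not be maximal: smoothness and immersivity of maps do not depend on
  which atlas represents the smooth structure.  The dimension is \<open>CARD('m)\<close>, which is positive.
\<close>

definition smooth_manifold :: "'a topology \<Rightarrow> ('a, 'm::finite) chart set \<Rightarrow> bool" where
  "smooth_manifold X \<A> \<longleftrightarrow>
     Hausdorff_space X \<and> second_countable X \<and>
     (\<forall>c\<in>\<A>. is_chart X c) \<and> (\<Union>c\<in>\<A>. fst c) = topspace X \<and>
     (\<forall>c\<in>\<A>. \<forall>d\<in>\<A>. compatible_charts c d)"

definition closed_manifold :: "'a topology \<Rightarrow> ('a, 'm::finite) chart set \<Rightarrow> bool" where
  "closed_manifold X \<A> \<longleftrightarrow> smooth_manifold X \<A> \<and> compact_space X"

definition smooth_map ::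
  "('a, 'm::finite) chart set \<Rightarrow> ('a \<Rightarrow> 'b::real_normed_vector) \<Rightarrow> bool" where
  "smooth_map \<A> f \<longleftrightarrow> (\<forall>(U, \<phi>)\<in>\<A>. smooth_on (\<phi> ` U) (f \<circ> inv_into U \<phi>))"

definition immersion ::
  "('a, 'm::finite) chart set \<Rightarrow> ('a \<Rightarrow> 'b::real_normed_vector) \<Rightarrow> bool" where
  "immersion \<A> f \<longleftrightarrow> smooth_map \<A> f \<and>
     (\<forall>(U, \<phi>)\<in>\<A>. \<forall>x\<in>U. inj (frechet_derivative (f \<circ> inv_into U \<phi>) (at (\<phi> x))))"

definition smooth_embedding ::
  "'a topology \<Rightarrow> ('a, 'm::finite) chart set \<Rightarrow> ('a \<Rightarrow> 'b::real_normed_vector) \<Rightarrow> bool" where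
  "smooth_embedding X \<A> f \<longleftrightarrow> immersion \<A> f \<and> embedding_map X euclidean f"

text \<open>The points \<open>p\<^sub>1, \<dots>, p\<^sub>\<ell>\<close> are given as a family over an index type with \<open>\<ell>\<close> elements.\<close>

definition distance_squared_mapping ::
  "('l::finite \<Rightarrow> real ^ 'n::finite) \<Rightarrow> real ^ 'n \<Rightarrow> real ^ 'l" where
  "distance_squared_mapping p x = (\<chi> j. (dist (p j) x)\<^sup>2)"

end

theory Submission
  imports Defs
begin

text \<open>
  If the points \<open>p j\<close> affinely span a hyperplane \<open>H\<close>, the values \<open>dist (p j) x ^ 2\<close> determine
  exactly the orthogonal projection of \<open>x\<close> to \<open>H\<close> and the square of the distance from \<open>x\<close> to
  \<open>H\<close>.  So the distance-squared mapping folds space along \<open>H\<close>: it identifies mirror images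
  in \<open>H\<close>, and the kernel of its derivative is trivial off \<open>H\<close> and is the normal line on \<open>H\<close>.
  It therefore suffices to find points of the hypersurface \<open>S = i ` topspace M\<close> spanning a
  hyperplane \<open>H\<close> such that \<open>S\<close> contains no two distinct mirror images and is never tangent to
  the normal direction along \<open>H\<close>.

  A hyperplane that cuts a tiny cap off \<open>S\<close> will do.  Let \<open>x0\<close> be a point of \<open>S\<close> farthest from
  some \<open>c \<notin> S\<close>, put \<open>a = x0 - c\<close>, and measure depth below \<open>x0\<close> by \<open>(x0 - z) \<bullet> a\<close>.
  Since \<open>S\<close> lies in a ball with \<open>x0\<close> on its boundary, points of small depth are close to \<open>x0\<close>,
  and near \<open>x0\<close> the set \<open>S\<close> is a graph over its tangent space, which is the orthogonal
  complement of \<open>a\<close>.  Let \<open>H\<close> be the hyperplane of points of depth \<open>\<epsilon>\<close>.  The depths of two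
  mirror images in \<open>H\<close> add up to \<open>2 * \<epsilon>\<close>; if both points lie in \<open>S\<close>, both depths are
  nonnegative, hence small, so both points are on the graph, and as they differ by a multiple of \<open>a\<close>, they
  coincide.  In the same way \<open>S \<inter> H\<close> lies on the graph, whose tangent spaces do not contain
  \<open>a\<close>.  That \<open>S \<inter> H\<close> spans \<open>H\<close> is \<open>exists_spanning_slice\<close>: along each ray of the tangent space
  the depth of the graph is \<open>0\<close> at the start and positive afterwards, so it takes every small
  value \<open>\<epsilon>\<close>, and points on rays whose
  directions are the vertices of a simplex around the origin are affinely independent.

  The graph property is the injectivity of \<open>\<pi> \<circ> F\<close>, where \<open>F\<close> is \<open>i\<close> in a chart and \<open>\<pi>\<close> is
  the projection along \<open>a\<close> (\<open>C1_locally_injective\<close>).  A statement about one chart passes to all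
  others by \<open>range_derivative_chart_change\<close>.
\<close>

section \<open>Closure properties of \<open>C\<^sup>k\<close> maps\<close>

lemma Ck_on_cong:
  assumes "open S" "\<And>x. x \<in> S \<Longrightarrow> f x = g x"
  shows "Ck_on k S f \<longleftrightarrow> Ck_on k S g"
  using assms
proof (induction k arbitrary: f g)
  case 0
  then show ?case by (simp cong: continuous_on_cong)
next
  case (Suc k)
  have D: "(f has_derivative D) (at x) \<longleftrightarrow> (g has_derivative D) (at x)" if "x \<in> S" for x D
    using has_derivative_transform_within_open[OF _ Suc.prems(1) that] Suc.prems(2) by metis
  have "frechet_derivative f (at x) = frechet_derivative g (at x)" if "x \<in> S" for x
    unfolding frechet_derivative_def using D[OF that] by simp
  then have "Ck_on k S (\<lambda>x. frechet_derivative f (at x) v)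
      \<longleftrightarrow> Ck_on k S (\<lambda>x. frechet_derivative g (at x) v)" for v
    by (intro Suc.IH[OF Suc.prems(1)]) simp
  moreover have "f differentiable (at x) \<longleftrightarrow> g differentiable (at x)" if "x \<in> S" for x
    unfolding differentiable_def using D[OF that] by simp
  ultimately show ?case by simp
qed

lemma Ck_on_Suc_derivative:
  assumes "Ck_on (Suc k) S f" "x \<in> S"
  shows "(f has_derivative frechet_derivative f (at x)) (at x)"
  using assms frechet_derivative_works by auto

text \<open>
  The class \<open>C\<^sup>k\<close> is defined through the chosen derivative; this rule accepts any formula for the
  derivative, so that the closure lemmas below are inductions along the differentiation rules.
\<close>

lemma Ck_on_SucI:
  assumes "open S" "\<And>x. x \<in> S \<Longrightarrow> (f has_derivative f' x) (at x)"
    and "\<And>v. Ck_on k S (\<lambda>x. f' x v)"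
  shows "Ck_on (Suc k) S f"
proof -
  have "frechet_derivative f (at x) = f' x" if "x \<in> S" for x
    using frechet_derivative_at[OF assms(2)[OF that]] by simp
  then have "Ck_on k S (\<lambda>x. frechet_derivative f (at x) v) \<longleftrightarrow> Ck_on k S (\<lambda>x. f' x v)" for v
    by (intro Ck_on_cong[OF assms(1)]) simp
  with assms show ?thesis by (auto simp: differentiable_def)
qed

lemma Ck_on_mono:
  "Ck_on (Suc k) S f \<Longrightarrow> Ck_on k S f"
proof (induction k arbitrary: f)
  case 0
  then show ?case
    by (auto intro!: continuous_at_imp_continuous_on differentiable_imp_continuous_within)
next
  case (Suc k)
  have "Ck_on k S (\<lambda>x. frechet_derivative f (at x) v)" for v
    using Suc.prems by (intro Suc.IH) simp
  with Suc.prems show ?case by simp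
qed

lemma Ck_on_const: "Ck_on k S (\<lambda>x. c)"
  by (induction k arbitrary: c) auto

lemma Ck_on_add:
  assumes "open S" "Ck_on k S f" "Ck_on k S g"
  shows "Ck_on k S (\<lambda>x. f x + g x)"
  using assms(2,3)
proof (induction k arbitrary: f g)
  case 0
  then show ?case by (simp add: continuous_on_add)
next
  case (Suc k)
  show ?case
  proof (rule Ck_on_SucI[OF assms(1) has_derivative_add])
    show "(f has_derivative frechet_derivative f (at x)) (at x)" if "x \<in> S" for x
      by (rule Ck_on_Suc_derivative[OF Suc.prems(1) that])
    show "(g has_derivative frechet_derivative g (at x)) (at x)" if "x \<in> S" for x
      by (rule Ck_on_Suc_derivative[OF Suc.prems(2) that])
  qed (use Suc in auto)
qed

lemma Ck_on_bounded_linear: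
  assumes "open S" "bounded_linear L" "Ck_on k S f"
  shows "Ck_on k S (\<lambda>x. L (f x))"
  using assms(3)
proof (induction k arbitrary: f)
  case 0
  then show ?case using bounded_linear.continuous_on[OF assms(2)] by simp
next
  case (Suc k)
  show ?case
  proof (rule Ck_on_SucI[OF assms(1) bounded_linear.has_derivative[OF assms(2)]])
    show "(f has_derivative frechet_derivative f (at x)) (at x)" if "x \<in> S" for x
      by (rule Ck_on_Suc_derivative[OF Suc.prems that])
  qed (use Suc in auto)
qed

lemma Ck_on_bounded_bilinear:
  assumes "open S" "bounded_bilinear b" "Ck_on k S f" "Ck_on k S g"
  shows "Ck_on k S (\<lambda>x. b (f x) (g x))"
  using assms(3,4)
proof (induction k arbitrary: f g)
  case 0
  then show ?case using bounded_bilinear.continuous_on[OF assms(2)] by simp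
next
  case (Suc k)
  show ?case
  proof (rule Ck_on_SucI[OF assms(1) bounded_bilinear.FDERIV[OF assms(2)]])
    show "(f has_derivative frechet_derivative f (at x)) (at x)" if "x \<in> S" for x
      by (rule Ck_on_Suc_derivative[OF Suc.prems(1) that])
    show "(g has_derivative frechet_derivative g (at x)) (at x)" if "x \<in> S" for x
      by (rule Ck_on_Suc_derivative[OF Suc.prems(2) that])
    show "Ck_on k S (\<lambda>x. b (f x) (frechet_derivative g (at x) v)
            + b (frechet_derivative f (at x) v) (g x))" for v
      by (rule Ck_on_add[OF assms(1)]; rule Suc.IH)
         (use Suc.prems Ck_on_mono in auto)
  qed
qed

section \<open>Distance-squared mappings\<close>

text \<open>
  Constant plus linear part plus the norm square in every coordinate: smoothness and the
  derivative follow from the rules for linear and bilinear maps.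
\<close>

lemma distance_squared_mapping_expand:
  "distance_squared_mapping p z =
     (\<chi> j. (norm (p j))\<^sup>2) + (- 2 *\<^sub>R (\<chi> j. p j \<bullet> z) + (z \<bullet> z) *\<^sub>R 1)"
  by (simp add: distance_squared_mapping_def vec_eq_iff dist_norm power2_norm_eq_inner
      inner_diff inner_commute)

lemma bounded_linear_inner_family:
  "bounded_linear (\<lambda>z::'a::euclidean_space. (- 2) *\<^sub>R (\<chi> j. (p :: 'l::finite \<Rightarrow> 'a) j \<bullet> z))"
  by (intro linear_conv_bounded_linear[THEN iffD1] linearI)
     (auto simp: vec_eq_iff inner_add algebra_simps)

lemma smooth_on_distance_squared_mapping:
  assumes "open S" "smooth_on S f"
  shows "smooth_on S (\<lambda>x. distance_squared_mapping p (f x))"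
  unfolding distance_squared_mapping_expand smooth_on_def
proof
  fix k
  have f: "Ck_on k S f" using assms(2) by (simp add: smooth_on_def)
  show "Ck_on k S (\<lambda>x. (\<chi> j. (norm (p j))\<^sup>2) +
          (- 2 *\<^sub>R (\<chi> j. p j \<bullet> f x) + (f x \<bullet> f x) *\<^sub>R 1))"
    by (intro Ck_on_add assms(1) Ck_on_const
        Ck_on_bounded_linear[OF assms(1) bounded_linear_inner_family f]
        Ck_on_bounded_linear[OF assms(1) bounded_linear_scaleR_left]
        Ck_on_bounded_bilinear[OF assms(1) bounded_bilinear_inner f f])
qed

lemma has_derivative_distance_squared_mapping:
  "(distance_squared_mapping p has_derivative (\<lambda>w. \<chi> j. 2 * ((z - p j) \<bullet> w))) (at z)"
proof -
  have eq: "(\<lambda>w. \<chi> j. 2 * ((z - p j) \<bullet> w)) =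
    (\<lambda>w. 0 + (- 2 *\<^sub>R (\<chi> j. p j \<bullet> w) + (z \<bullet> w + w \<bullet> z) *\<^sub>R 1))"
    by (auto simp: fun_eq_iff vec_eq_iff inner_diff inner_commute)
  show ?thesis
    unfolding distance_squared_mapping_expand[abs_def] eq
    by (intro has_derivative_add has_derivative_const has_derivative_scaleR_left
        bounded_linear.has_derivative[OF bounded_linear_inner_family has_derivative_ident]
        has_derivative_inner[OF has_derivative_ident has_derivative_ident])
qed

text \<open>
  Points with the same image are mirror images: their difference is normal to the span of the
  \<open>p j\<close>, and their midpoint lies on the hyperplane through \<open>p j\<close> orthogonal to that difference.
\<close>

lemma distance_squared_mapping_eqD:
  assumes "distance_squared_mapping p x = distance_squared_mapping p y"
  shows "(x + y - 2 *\<^sub>R p j) \<bullet> (x - y) = 0" and "(p j - p k) \<bullet> (x - y) = 0"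
proof -
  have *: "(x + y - 2 *\<^sub>R p j) \<bullet> (x - y) = 0" for j
    using arg_cong[OF assms, of "\<lambda>v. v $ j"]
    by (simp add: distance_squared_mapping_def dist_norm power2_norm_eq_inner
        inner_diff inner_add inner_commute)
  show "(x + y - 2 *\<^sub>R p j) \<bullet> (x - y) = 0" by (rule *)
  show "(p j - p k) \<bullet> (x - y) = 0"
    using *[of j] *[of k] by (simp add: inner_diff inner_add algebra_simps)
qed

section \<open>A balanced spanning family\<close>

text \<open>
  These are the vertices of a simplex with barycentre \<open>0\<close>: the coordinate vectors and minus their
  sum.
\<close>

lemma exists_balanced_spanning_family:
  assumes "CARD('n::finite) = CARD('m::finite) + 1"
  shows "\<exists>v :: 'n \<Rightarrow> real ^ 'm. (\<forall>j. v j \<noteq> 0) \<and> sum v UNIV = 0 \<and> span (range v) = UNIV"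
proof -
  obtain j0 :: 'n where True by auto
  have "card (UNIV - {j0}) = card (UNIV :: 'm set)"
    using assms by (simp add: card_Diff_singleton)
  then obtain b where b: "bij_betw b (UNIV - {j0}) (UNIV :: 'm set)"
    by (metis finite_same_card_bij finite)
  \<comment> \<open>\<open>1\<close> is the vector with all coordinates \<open>1\<close>.\<close>
  define v :: "'n \<Rightarrow> real ^ 'm" where "v j = (if j = j0 then - 1 else axis (b j) 1)" for j
  have "sum v UNIV = v j0 + (\<Sum>j\<in>UNIV - {j0}. v j)"
    by (simp add: sum.remove[of UNIV j0])
  also have "(\<Sum>j\<in>UNIV - {j0}. v j) = (\<Sum>j\<in>UNIV - {j0}. axis (b j) 1)"
    by (intro sum.cong) (auto simp: v_def)
  also have "\<dots> = (\<Sum>k\<in>UNIV. axis k 1)"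
    by (rule sum.reindex_bij_betw[OF b])
  also have "\<dots> = 1"
    by (simp add: vec_eq_iff axis_def)
  finally have "sum v UNIV = 0" by (simp add: v_def)
  moreover have "v j \<noteq> 0" for j by (simp add: v_def axis_eq_0_iff)
  moreover have "Basis \<subseteq> range v"
  proof
    fix e :: "real ^ 'm" assume "e \<in> Basis"
    then obtain k where "e = axis k 1" by (auto simp: Basis_vec_def)
    moreover obtain j where "j \<noteq> j0" "b j = k"
      using b by (metis DiffE UNIV_I bij_betw_iff_bijections insertCI)
    ultimately show "e \<in> range v" by (auto simp: v_def intro!: image_eqI[of _ _ j])
  qed
  then have "span (range v) = UNIV" by (metis span_Basis span_mono top.extremum_uniqueI)
  ultimately show ?thesis by blast
qed

text \<open>
  Moving the vertices of a simplex around \<open>0\<close> along their rays keeps them affinely independent.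
  In dual form: if \<open>\<beta>\<close> takes one value \<open>\<gamma>\<close> at all the points \<open>t j *\<^sub>R v j\<close>, then
  \<open>0 = \<beta> (sum v UNIV)\<close> is \<open>\<gamma>\<close> times a sum of positive numbers.
\<close>

lemma balanced_spanning_family_linear_eq_0:
  fixes v :: "'n::finite \<Rightarrow> 'v::real_vector" and \<beta> :: "'v \<Rightarrow> real"
  assumes "linear \<beta>" "sum v UNIV = 0" "span (range v) = UNIV"
    and pos: "\<And>j. t j > 0" and const: "\<And>j k. \<beta> (t j *\<^sub>R v j) = \<beta> (t k *\<^sub>R v k)"
  shows "\<beta> u = 0"
proof -
  define \<gamma> where "\<gamma> = \<beta> (t undefined *\<^sub>R v undefined)"
  have \<beta>v: "\<beta> (v j) = \<gamma> * (1 / t j)" for j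
    using const[of j undefined] pos[of j] assms(1)
    by (simp add: \<gamma>_def linear_scale field_simps)
  have "0 = (\<Sum>j\<in>UNIV. \<beta> (v j))"
    using assms(1,2) by (metis linear_0 linear_sum)
  also have "\<dots> = \<gamma> * (\<Sum>j\<in>UNIV. 1 / t j)"
    by (simp add: \<beta>v sum_distrib_left)
  finally have "\<gamma> = 0 \<or> (\<Sum>j\<in>UNIV. 1 / t j) = 0" by simp
  moreover have "(\<Sum>j\<in>UNIV. 1 / t j) > 0"
    using pos by (intro sum_pos) auto
  ultimately have "\<gamma> = 0" by linarith
  then show ?thesis
    using linear_eq_0_on_span[OF assms(1), of "range v" u] assms(3) \<beta>v by auto
qed

section \<open>Local behaviour of the hypersurface\<close>

text \<open>
  The derivatives near \<open>y0\<close> are within operator distance \<open>1\<close> of the identity and so cannot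
  annihilate a nonzero vector.
\<close>

lemma C1_locally_injective:
  fixes g :: "'e::euclidean_space \<Rightarrow> 'e"
  assumes "open W" "y0 \<in> W" "Ck_on 1 W g"
    and id: "\<And>v. frechet_derivative g (at y0) v = v"
  obtains r where "r > 0" "ball y0 r \<subseteq> W" "inj_on g (ball y0 r)"
    "\<And>y. y \<in> ball y0 r \<Longrightarrow> inj (frechet_derivative g (at y))"
proof -
  define g' where "g' y = frechet_derivative g (at y)" for y
  have der: "(g has_derivative g' y) (at y)" if "y \<in> W" for y
    using Ck_on_Suc_derivative[of 0 W g y] assms(3) that by (simp add: g'_def)
  have cont: "continuous_on W (\<lambda>y. g' y v)" for v
    using assms(3) by (simp add: g'_def)
  \<comment> \<open>Only directional derivatives are known to be continuous; those along the finite basis bound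
    the operator norm.\<close>
  have close: "\<exists>d>0. \<forall>y. dist y0 y < d \<longrightarrow> y \<in> W \<and> onorm (\<lambda>v. g' y v - g' y0 v) < e"
    if "e > 0" for e
  proof -
    have "isCont (\<lambda>y. \<Sum>b\<in>Basis. norm (g' y b - g' y0 b)) y0"
      using cont assms(1,2) by (intro continuous_intros) (auto simp: continuous_on_eq_continuous_at)
    then have "((\<lambda>y. \<Sum>b\<in>Basis. norm (g' y b - g' y0 b)) \<longlongrightarrow> 0) (nhds y0)"
      by (simp add: continuous_at_imp_continuous_at_within isCont_def tendsto_nhds_iff)
    then have "\<forall>\<^sub>F y in nhds y0. (\<Sum>b\<in>Basis. norm (g' y b - g' y0 b)) < e"
      using that by (rule order_tendstoD)
    moreover have "\<forall>\<^sub>F y in nhds y0. y \<in> W"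
      using assms(1,2) by (rule eventually_nhds_in_open)
    ultimately have "\<forall>\<^sub>F y in nhds y0. y \<in> W \<and> onorm (\<lambda>v. g' y v - g' y0 v) < e"
    proof eventually_elim
      case (elim y)
      have "bounded_linear (\<lambda>v. g' y v - g' y0 v)"
        using der[OF elim(2)] der[OF assms(2)] by (simp add: bounded_linear_sub has_derivative_bounded_linear)
      from onorm_componentwise[OF this] elim show ?case by simp
    qed
    then show ?thesis by (auto simp: eventually_nhds_metric dist_commute)
  qed
  obtain r1 where r1: "r1 > 0" "ball y0 r1 \<subseteq> W" "inj_on g (ball y0 r1)"
  proof (rule has_derivative_locally_injective[OF assms(2,1) _ _ der])
    show "bounded_linear (id :: 'e \<Rightarrow> 'e)" by (simp add: bounded_linear_ident id_def)
    show "id \<circ> g' y0 = id" by (auto simp: g'_def id)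
    show "\<exists>d>0. \<forall>x. dist y0 x < d \<longrightarrow> onorm (\<lambda>v. g' x v - g' y0 v) < e" if "e > 0" for e
      using close[OF that] by blast
  qed
  obtain r2 where r2: "r2 > 0"
    "\<And>y. dist y0 y < r2 \<Longrightarrow> y \<in> W \<and> onorm (\<lambda>v. g' y v - g' y0 v) < 1"
    using close[of 1] by auto
  show thesis
  proof (rule that[of "min r1 r2"])
    show "inj (frechet_derivative g (at y))" if "y \<in> ball y0 (min r1 r2)" for y
    proof -
      have y: "y \<in> W" "onorm (\<lambda>v. g' y v - g' y0 v) < 1" using r2 that by auto
      have bl: "bounded_linear (g' y)" "bounded_linear (g' y0)"
        using der y(1) assms(2) has_derivative_bounded_linear by blast+
      have "v = 0" if "g' y v = 0" for v
      proof (rule ccontr)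
        assume "v \<noteq> 0"
        have "norm v = norm (g' y v - g' y0 v)" using that id by (simp add: g'_def)
        also have "\<dots> \<le> onorm (\<lambda>v. g' y v - g' y0 v) * norm v"
          by (rule onorm[OF bounded_linear_sub[OF bl]])
        also have "\<dots> < 1 * norm v"
          by (rule mult_strict_right_mono) (use y \<open>v \<noteq> 0\<close> in auto)
        finally show False by simp
      qed
      then show ?thesis
        using bl(1) by (simp add: g'_def linear_injective_0 bounded_linear.linear)
    qed
  qed (use r1 r2 in \<open>auto intro: inj_on_subset\<close>)
qed

text \<open>
  By the dimension count, \<open>(u, s) \<mapsto> L u + s *\<^sub>R a\<close> is an isomorphism; the projection is the first
  component of its inverse.
\<close>

lemma exists_projection_along_normal:
  fixes L :: "real ^ 'm::finite \<Rightarrow> real ^ 'n::finite"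
  assumes "linear L" "inj L" "a \<noteq> 0" "\<And>u. L u \<bullet> a = 0" "CARD('n) = CARD('m) + 1"
  obtains \<pi> where "linear \<pi>" "\<And>u s. \<pi> (L u + s *\<^sub>R a) = u"
    "\<And>w. \<exists>u s. w = L u + s *\<^sub>R a"
proof -
  define T where "T = (\<lambda>(u, s). L u + s *\<^sub>R a)"
  have lin: "linear T"
    unfolding T_def using assms(1)
    by (intro linearI) (auto simp: linear_add linear_scale algebra_simps)
  have "x = 0" if "T x = 0" for x
  proof -
    obtain u s where x: "x = (u, s)" by (cases x)
    have "(L u + s *\<^sub>R a) \<bullet> a = 0" using that x by (simp add: T_def)
    then have "s = 0" using assms(3,4) by (simp add: inner_add)
    moreover from this have "L u = 0" using that x by (simp add: T_def)
    then have "u = 0" using assms(1,2) linear_injective_0 by blast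
    ultimately show ?thesis using x by (simp add: zero_prod_def)
  qed
  then have inj: "inj T" using lin linear_injective_0 by blast
  obtain G where G: "linear G" "G \<circ> T = id"
    using linear_injective_left_inverse[OF lin inj] by blast
  have "surj T"
    by (rule eucl.linear_injective_imp_surjective[OF lin inj]) (simp add: assms(5) dim_UNIV)
  show thesis
  proof
    show "linear (fst \<circ> G)" using G(1) linear_compose linear_fst by blast
    show "(fst \<circ> G) (L u + s *\<^sub>R a) = u" for u s
      using fun_cong[OF G(2), of "(u, s)"] by (simp add: T_def)
    show "\<exists>u s. w = L u + s *\<^sub>R a" for w
      using \<open>surj T\<close> unfolding surj_def T_def by (metis case_prod_conv surj_pair)
  qed
qed

text \<open>
  By invariance of domain \<open>g\<close> is a homeomorphism onto an open set, so a short segment of the ray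
  from \<open>g y0\<close> in direction \<open>v\<close> lifts to \<open>B\<close>; along the lift \<open>h\<close> takes every small positive value.
\<close>

lemma level_set_meets_rays:
  fixes g :: "'e::euclidean_space \<Rightarrow> 'e" and h :: "'e \<Rightarrow> real"
  assumes "open B" "y0 \<in> B" "continuous_on B g" "inj_on g B" "continuous_on B h"
    and "h y0 = 0" "\<And>y. y \<in> B \<Longrightarrow> y \<noteq> y0 \<Longrightarrow> h y > 0" and "v \<noteq> 0"
  obtains e where "e > 0"
    "\<And>\<epsilon>. 0 < \<epsilon> \<Longrightarrow> \<epsilon> \<le> e \<Longrightarrow> \<exists>t>0. \<exists>y\<in>B. g y = g y0 + t *\<^sub>R v \<and> h y = \<epsilon>"
proof -
  obtain G where G: "homeomorphism B (g ` B) g G"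
    using invariance_of_domain_homeomorphism[OF assms(1,3) _ assms(4)] by auto
  have "open (g ` B)" by (rule invariance_of_domain[OF assms(3,1,4)])
  then obtain r where r: "r > 0" "ball (g y0) r \<subseteq> g ` B"
    using assms(2) open_contains_ball by blast
  define \<delta> where "\<delta> = r / (2 * norm v)"
  have \<delta>: "\<delta> > 0" using r assms(8) by (simp add: \<delta>_def)
  have ray: "g y0 + t *\<^sub>R v \<in> g ` B" if "0 \<le> t" "t \<le> \<delta>" for t
  proof -
    have "t * norm v \<le> \<delta> * norm v" using that by (simp add: mult_right_mono)
    also have "\<dots> < r" using r assms(8) by (simp add: \<delta>_def)
    finally have "g y0 + t *\<^sub>R v \<in> ball (g y0) r"
      using that by (simp add: dist_norm)
    with r show ?thesis by blast
  qed
  have GB: "G (g y0 + t *\<^sub>R v) \<in> B" "g (G (g y0 + t *\<^sub>R v)) = g y0 + t *\<^sub>R v"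
    if "0 \<le> t" "t \<le> \<delta>" for t
    using G ray[OF that] by (auto simp: homeomorphism_def)
  define q where "q t = h (G (g y0 + t *\<^sub>R v))" for t
  have cont: "continuous_on {0..\<delta>} q"
    unfolding q_def
  proof (rule continuous_on_compose2[OF assms(5)])
    show "continuous_on {0..\<delta>} (\<lambda>t. G (g y0 + t *\<^sub>R v))"
      using ray by (intro continuous_on_compose2[OF homeomorphism_cont2[OF G]] continuous_intros) auto
  qed (use GB in auto)
  have q0: "q 0 = 0"
    using G assms(2,6) by (simp add: q_def homeomorphism_def)
  have "G (g y0 + \<delta> *\<^sub>R v) \<noteq> y0"
    using GB(2)[of \<delta>] \<delta> assms(8) by auto
  then have q\<delta>: "q \<delta> > 0"
    unfolding q_def using GB(1)[of \<delta>] \<delta> by (intro assms(7)) auto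
  show thesis
  proof (rule that[OF q\<delta>])
    fix \<epsilon> assume \<epsilon>: "0 < \<epsilon>" "\<epsilon> \<le> q \<delta>"
    obtain t where t: "0 \<le> t" "t \<le> \<delta>" "q t = \<epsilon>"
      using IVT'[OF _ \<epsilon>(2) _ cont] q0 \<epsilon>(1) \<delta> by auto
    moreover have "t \<noteq> 0" using t q0 \<epsilon>(1) by auto
    ultimately show "\<exists>t>0. \<exists>y\<in>B. g y = g y0 + t *\<^sub>R v \<and> h y = \<epsilon>"
      using GB[of t] by (intro exI[of _ t] conjI bexI[of _ "G (g y0 + t *\<^sub>R v)"]) (auto simp: q_def)
  qed
qed

text \<open>
  The spanning property is stated by duality: only multiples of \<open>a\<close> are orthogonal to all
  differences \<open>p j - p k\<close>.  One \<open>\<epsilon>\<close> serves all the finitely many rays.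
\<close>

lemma exists_spanning_slice:
  fixes F L :: "real ^ 'm::finite \<Rightarrow> real ^ 'n::finite"
  assumes card: "CARD('n) = CARD('m) + 1"
    and B: "open B" "y0 \<in> B" "continuous_on B F"
    and L: "linear L" "\<And>u. L u \<bullet> a = 0" and "a \<noteq> 0"
    and \<pi>: "linear \<pi>" "\<And>u s. \<pi> (L u + s *\<^sub>R a) = u" "\<And>w. \<exists>u s. w = L u + s *\<^sub>R a"
    and inj: "inj_on (\<pi> \<circ> F) B"
    and cap: "\<And>y. y \<in> B \<Longrightarrow> (dist (F y0) (F y))\<^sup>2 \<le> 2 * ((F y0 - F y) \<bullet> a)"
    and "\<epsilon>0 > 0"
  obtains p :: "'n \<Rightarrow> real ^ 'n" and \<epsilon> where "0 < \<epsilon>" "\<epsilon> < \<epsilon>0"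
    "\<And>j. p j \<in> F ` B" "\<And>j. (F y0 - p j) \<bullet> a = \<epsilon>"
    "\<And>w. (\<And>j k. (p j - p k) \<bullet> w = 0) \<Longrightarrow> \<exists>s. w = s *\<^sub>R a"
proof -
  obtain v :: "'n \<Rightarrow> real ^ 'm" where v: "\<And>j. v j \<noteq> 0" "sum v UNIV = 0" "span (range v) = UNIV"
    using exists_balanced_spanning_family[OF card] by blast
  define h where "h y = (F y0 - F y) \<bullet> a" for y
  have h_pos: "h y > 0" if "y \<in> B" "y \<noteq> y0" for y
  proof -
    have "F y0 \<noteq> F y" using inj B(2) that by (auto simp: inj_on_def)
    then show ?thesis using cap[OF that(1)] by (smt (verit) h_def zero_less_dist_iff zero_less_power)
  qed
  have "\<exists>e>0. \<forall>\<epsilon>. 0 < \<epsilon> \<longrightarrow> \<epsilon> \<le> e \<longrightarrow>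
          (\<exists>t>0. \<exists>y\<in>B. (\<pi> \<circ> F) y = (\<pi> \<circ> F) y0 + t *\<^sub>R v j \<and> h y = \<epsilon>)" for j
  proof (rule level_set_meets_rays[OF B(1,2) _ inj, where h = h and v = "v j"])
    show "continuous_on B (\<pi> \<circ> F)"
      using B(3) \<pi>(1) linear_continuous_on linear_conv_bounded_linear
      by (metis continuous_on_compose)
    show "continuous_on B h" unfolding h_def using B(3) by (intro continuous_intros)
  qed (use h_pos v in \<open>auto simp: h_def\<close>)
  then obtain e where e: "\<And>j. e j > 0"
    "\<And>j \<epsilon>. 0 < \<epsilon> \<Longrightarrow> \<epsilon> \<le> e j \<Longrightarrow>
       \<exists>t>0. \<exists>y\<in>B. (\<pi> \<circ> F) y = (\<pi> \<circ> F) y0 + t *\<^sub>R v j \<and> h y = \<epsilon>"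
    by metis
  define \<epsilon> where "\<epsilon> = min (\<epsilon>0 / 2) (Min (range e))"
  have \<epsilon>: "0 < \<epsilon>" "\<epsilon> < \<epsilon>0" "\<epsilon> \<le> e j" for j
    using e(1) \<open>\<epsilon>0 > 0\<close> by (auto simp: \<epsilon>_def min_le_iff_disj)
  obtain t y where ty: "\<And>j. t j > 0" "\<And>j. y j \<in> B" "\<And>j. h (y j) = \<epsilon>"
    "\<And>j. \<pi> (F (y j)) = \<pi> (F y0) + t j *\<^sub>R v j"
    using e(2)[OF \<epsilon>(1,3)] by (metis comp_apply)
  \<comment> \<open>All points have the same depth, so their differences lie in the range of \<open>L\<close>.\<close>
  have diff: "F (y j) - F (y k) = L (t j *\<^sub>R v j - t k *\<^sub>R v k)" for j k
  proof -
    obtain u s where us: "F (y j) - F (y k) = L u + s *\<^sub>R a" using \<pi>(3) by blast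
    have "(F (y j) - F (y k)) \<bullet> a = 0" using ty(3)[of j] ty(3)[of k] by (simp add: h_def inner_diff)
    then have "s = 0" using us L(2) \<open>a \<noteq> 0\<close> by (simp add: inner_add)
    moreover have "u = t j *\<^sub>R v j - t k *\<^sub>R v k"
      using arg_cong[OF us, of \<pi>] \<pi>(1,2) ty(4) by (simp add: linear_diff)
    ultimately show ?thesis using us by simp
  qed
  show thesis
  proof
    show "0 < \<epsilon>" "\<epsilon> < \<epsilon>0" by (fact \<epsilon>)+
    show "F (y j) \<in> F ` B" "(F y0 - F (y j)) \<bullet> a = \<epsilon>" for j
      using ty by (auto simp: h_def)
    show "\<exists>s. w = s *\<^sub>R a" if w: "\<And>j k. (F (y j) - F (y k)) \<bullet> w = 0" for w
    proof -
      obtain u s where us: "w = L u + s *\<^sub>R a" using \<pi>(3) by blast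
      define \<beta> where "\<beta> x = L x \<bullet> L u" for x
      have "linear \<beta>"
        unfolding \<beta>_def using L(1) by (intro linearI) (auto simp: linear_add linear_scale inner_add)
      moreover have "\<beta> (t j *\<^sub>R v j) = \<beta> (t k *\<^sub>R v k)" for j k
        using w[of j k] L(1,2) by (simp add: diff us \<beta>_def linear_diff inner_add inner_diff)
      ultimately have "\<beta> u = 0"
        using balanced_spanning_family_linear_eq_0[where t = t] v(2,3) ty(1) by blast
      then show ?thesis using us by (auto simp: \<beta>_def)
    qed
  qed
qed

section \<open>Charts\<close>

lemma is_chartD:
  assumes "is_chart X (U, \<phi>)"
  shows "openin X U" "open (\<phi> ` U)" "inj_on \<phi> U"
    and "\<And>T. openin X T \<Longrightarrow> open (\<phi> ` (U \<inter> T))"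
    and "\<And>B. open B \<Longrightarrow> openin X {x \<in> U. \<phi> x \<in> B}"
proof -
  have hom: "homeomorphic_map (subtopology X U) (top_of_set (\<phi> ` U)) \<phi>"
    and op: "openin X U" "open (\<phi> ` U)"
    using assms by (auto simp: is_chart_def)
  have top: "topspace (subtopology X U) = U"
    using openin_subset[OF op(1)] by auto
  show "openin X U" "open (\<phi> ` U)" by (fact op)+
  show "inj_on \<phi> U"
    using homeomorphic_imp_injective_map[OF hom] top by simp
  show "open (\<phi> ` (U \<inter> T))" if "openin X T" for T
  proof -
    have "openin (subtopology X U) (U \<inter> T)"
      using that by (auto simp: openin_subtopology)
    then have "openin (top_of_set (\<phi> ` U)) (\<phi> ` (U \<inter> T))"
      using homeomorphic_imp_open_map[OF hom] by (simp add: open_map_def)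
    then show ?thesis using op(2) openin_open_trans by blast
  qed
  show "openin X {x \<in> U. \<phi> x \<in> B}" if "open B" for B
  proof -
    have "openin (top_of_set (\<phi> ` U)) (\<phi> ` U \<inter> B)" using that by (auto simp: openin_open)
    then have "openin (subtopology X U) {x \<in> topspace (subtopology X U). \<phi> x \<in> \<phi> ` U \<inter> B}"
      using homeomorphic_imp_continuous_map[OF hom] openin_continuous_map_preimage by blast
    moreover have "{x \<in> topspace (subtopology X U). \<phi> x \<in> \<phi> ` U \<inter> B} = {x \<in> U. \<phi> x \<in> B}"
      using top by auto
    ultimately show ?thesis using op(1) openin_trans_full by metis
  qed
qed

lemma smooth_map_has_derivative:
  assumes "smooth_map \<A> f" "(U, \<phi>) \<in> \<A>" "y \<in> \<phi> ` U"
  shows "(f \<circ> inv_into U \<phi> has_derivative frechet_derivative (f \<circ> inv_into U \<phi>) (at y)) (at y)"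
proof -
  have "Ck_on (Suc 0) (\<phi> ` U) (f \<circ> inv_into U \<phi>)"
    using assms(1,2) unfolding smooth_map_def smooth_on_def by blast
  then show ?thesis using assms(3) by (rule Ck_on_Suc_derivative)
qed

text \<open>
  The range in question is the tangent space of the image at \<open>f x\<close>; the chain rule for the
  transition map shows that it does not depend on the chart.
\<close>

lemma range_derivative_chart_change:
  assumes "smooth_manifold X \<A>" "smooth_map \<A> f"
    and U: "(U, \<phi>) \<in> \<A>" "x \<in> U" and V: "(V, \<psi>) \<in> \<A>" "x \<in> V"
  shows "range (frechet_derivative (f \<circ> inv_into V \<psi>) (at (\<psi> x)))
           \<subseteq> range (frechet_derivative (f \<circ> inv_into U \<phi>) (at (\<phi> x)))"
proof -
  define \<tau> where "\<tau> = \<phi> \<circ> inv_into V \<psi>"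
  have chU: "is_chart X (U, \<phi>)" and chV: "is_chart X (V, \<psi>)"
    using assms by (auto simp: smooth_manifold_def)
  have op: "open (\<psi> ` (V \<inter> U))" using is_chartD(1)[OF chU] is_chartD(4)[OF chV] by blast
  have "compatible_charts (V, \<psi>) (U, \<phi>)" using assms by (auto simp: smooth_manifold_def)
  then have sm: "smooth_on (\<psi> ` (V \<inter> U)) \<tau>" by (simp add: compatible_charts_def \<tau>_def)
  have x: "\<psi> x \<in> \<psi> ` (V \<inter> U)" using U(2) V(2) by blast
  have "Ck_on (Suc 0) (\<psi> ` (V \<inter> U)) \<tau>" using sm unfolding smooth_on_def by blast
  from Ck_on_Suc_derivative[OF this x]
  have "(\<tau> has_derivative frechet_derivative \<tau> (at (\<psi> x))) (at (\<psi> x))" .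
  moreover have "\<tau> (\<psi> x) = \<phi> x" using is_chartD(3)[OF chV] V(2) by (simp add: \<tau>_def)
  moreover have "(f \<circ> inv_into U \<phi> has_derivative frechet_derivative (f \<circ> inv_into U \<phi>) (at (\<phi> x)))
      (at (\<phi> x))"
    using smooth_map_has_derivative[OF assms(2) U(1)] U(2) by simp
  ultimately have "((f \<circ> inv_into U \<phi>) \<circ> \<tau> has_derivative
      frechet_derivative (f \<circ> inv_into U \<phi>) (at (\<phi> x)) \<circ> frechet_derivative \<tau> (at (\<psi> x)))
      (at (\<psi> x))"
    by (metis diff_chain_at)
  moreover have "((f \<circ> inv_into U \<phi>) \<circ> \<tau>) y = (f \<circ> inv_into V \<psi>) y" if "y \<in> \<psi> ` (V \<inter> U)" for y
    using that is_chartD(3)[OF chU] is_chartD(3)[OF chV] by (auto simp: \<tau>_def)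
  ultimately have "(f \<circ> inv_into V \<psi> has_derivative
      frechet_derivative (f \<circ> inv_into U \<phi>) (at (\<phi> x)) \<circ> frechet_derivative \<tau> (at (\<psi> x)))
      (at (\<psi> x))"
    by (rule has_derivative_transform_within_open[OF _ op x])
  from frechet_derivative_at[OF this, symmetric] show ?thesis by auto
qed

section \<open>The embedding\<close>

theorem corollary1p1:
  fixes M :: "'a topology"
    and \<A> :: "('a, 'm::finite) chart set"
    and i :: "'a \<Rightarrow> real ^ 'n::finite"
  assumes "closed_manifold M \<A>"
    and "topspace M \<noteq> {}"
    and "CARD('n) = CARD('m) + 1"
    and "smooth_embedding M \<A> i"
  shows "\<exists>p :: 'n \<Rightarrow> real ^ 'n.
           (\<forall>j. p j \<in> i ` topspace M) \<and>
           smooth_embedding M \<A> (distance_squared_mapping p \<circ> i)"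
proof -
  define S where "S = i ` topspace M"
  have man: "smooth_manifold M \<A>" and cpt: "compact_space M"
    using assms(1) by (auto simp: closed_manifold_def)
  have imm: "immersion \<A> i" and emb: "embedding_map M euclidean i"
    using assms(4) by (auto simp: smooth_embedding_def)
  have sm: "smooth_map \<A> i" using imm by (simp add: immersion_def)
  have cont: "continuous_map M euclidean i"
    using emb by (simp add: embedding_map_def homeomorphic_imp_continuous_map continuous_map_in_subtopology)
      (metis continuous_map_in_subtopology homeomorphic_imp_continuous_map)
  have inj_i: "inj_on i (topspace M)"
    using emb by (simp add: embedding_map_def homeomorphic_map_def)
  have "compact S"
    using image_compactin[OF _ cont, of "topspace M"] cpt by (simp add: S_def compact_space_def)
  then obtain c where c: "c \<notin> S"
    by (metis UNIV_I not_compact_UNIV subsetI top.extremum_uniqueI)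
  obtain x0 where x0: "x0 \<in> S" "\<And>z. z \<in> S \<Longrightarrow> dist c z \<le> dist c x0"
    using distance_attains_sup[OF \<open>compact S\<close>] assms(2) unfolding S_def by blast
  obtain q where q: "q \<in> topspace M" "i q = x0" using x0(1) by (auto simp: S_def)
  define a where "a = x0 - c"
  have "a \<noteq> 0" using x0(1) c by (auto simp: a_def)
  \<comment> \<open>The two sides differ by \<open>dist c x0 ^ 2 - dist c z ^ 2\<close>.\<close>
  have cap: "(dist x0 z)\<^sup>2 \<le> 2 * ((x0 - z) \<bullet> a)" if "z \<in> S" for z
  proof -
    have "(dist c z)\<^sup>2 \<le> (dist c x0)\<^sup>2" using x0(2)[OF that] by simp
    then show ?thesis
      by (simp add: a_def dist_norm power2_norm_eq_inner inner_diff inner_commute)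
  qed

  obtain U \<phi> where U: "(U, \<phi>) \<in> \<A>" "q \<in> U"
    using man q(1) by (fastforce simp: smooth_manifold_def)
  have ch: "is_chart M (U, \<phi>)" using man U(1) by (auto simp: smooth_manifold_def)
  define F where "F = i \<circ> inv_into U \<phi>"
  define y0 where "y0 = \<phi> q"
  have W: "open (\<phi> ` U)" "y0 \<in> \<phi> ` U" using is_chartD(2)[OF ch] U(2) by (auto simp: y0_def)
  have F\<phi>: "F (\<phi> x) = i x" if "x \<in> U" for x
    using that is_chartD(3)[OF ch] by (simp add: F_def)
  have U_sub: "U \<subseteq> topspace M" using is_chartD(1)[OF ch] by (rule openin_subset)
  have F0: "F y0 = x0" using F\<phi>[OF U(2)] q(2) by (simp add: y0_def)
  have FS: "F y \<in> S" if "y \<in> \<phi> ` U" for y using that F\<phi> U_sub by (auto simp: S_def)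
  have smF: "smooth_on (\<phi> ` U) F" using sm U(1) by (auto simp: smooth_map_def F_def)
  have derF: "(F has_derivative frechet_derivative F (at y)) (at y)" if "y \<in> \<phi> ` U" for y
    using smooth_map_has_derivative[OF sm U(1) that] by (simp add: F_def)
  define L where "L = frechet_derivative F (at y0)"
  have "inj L"
    using imm U by (auto simp: immersion_def L_def F_def y0_def)
  have "linear L"
    using derF[OF W(2)] by (simp add: L_def has_derivative_bounded_linear bounded_linear.linear)
  \<comment> \<open>\<open>y0\<close> maximises the distance of \<open>F y\<close> from \<open>c\<close>.\<close>
  have perp: "L u \<bullet> a = 0" for u
  proof -
    have "((\<lambda>y. (F y - c) \<bullet> (F y - c)) has_derivative
        (\<lambda>u. (F y0 - c) \<bullet> (L u - 0) + (L u - 0) \<bullet> (F y0 - c))) (at y0)"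
      unfolding L_def by (intro has_derivative_inner has_derivative_diff has_derivative_const derF W(2))
    moreover have "\<forall>y\<in>\<phi> ` U. (F y - c) \<bullet> (F y - c) \<le> (F y0 - c) \<bullet> (F y0 - c)"
      using x0(2)[OF FS] by (metis F0 dist_commute dist_norm norm_le)
    ultimately have "(\<lambda>u. (F y0 - c) \<bullet> (L u - 0) + (L u - 0) \<bullet> (F y0 - c)) = (\<lambda>u. 0)"
      using differential_zero_maxmin[OF W(2,1)] by blast
    from fun_cong[OF this, of u] show ?thesis by (simp add: F0 a_def inner_commute)
  qed
  obtain \<pi> where \<pi>: "linear \<pi>" "\<And>u s. \<pi> (L u + s *\<^sub>R a) = u" "\<And>w. \<exists>u s. w = L u + s *\<^sub>R a"
    using exists_projection_along_normal[OF \<open>linear L\<close> \<open>inj L\<close> \<open>a \<noteq> 0\<close> perp assms(3)] by blast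
  have \<pi>bl: "bounded_linear \<pi>" using \<pi>(1) by (simp add: linear_conv_bounded_linear)
  have \<pi>a: "\<pi> (s *\<^sub>R a) = 0" for s using \<pi>(2)[of 0 s] \<open>linear L\<close> by (simp add: linear_0)

  have dg: "frechet_derivative (\<pi> \<circ> F) (at y) = \<pi> \<circ> frechet_derivative F (at y)" if "y \<in> \<phi> ` U" for y
    using frechet_derivative_at[OF bounded_linear.has_derivative[OF \<pi>bl derF[OF that]]]
    by (simp add: o_def)
  obtain r where r: "r > 0" "ball y0 r \<subseteq> \<phi> ` U" "inj_on (\<pi> \<circ> F) (ball y0 r)"
    "\<And>y. y \<in> ball y0 r \<Longrightarrow> inj (frechet_derivative (\<pi> \<circ> F) (at y))"
  proof (rule C1_locally_injective[OF W])
    have "Ck_on 1 (\<phi> ` U) F" using smF unfolding smooth_on_def by blast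
    then show "Ck_on 1 (\<phi> ` U) (\<pi> \<circ> F)"
      unfolding o_def by (rule Ck_on_bounded_linear[OF W(1) \<pi>bl])
    show "frechet_derivative (\<pi> \<circ> F) (at y0) v = v" for v
      using \<pi>(2)[of v 0] by (simp add: dg[OF W(2)] L_def)
  qed blast
  define B where "B = ball y0 r"
  have B: "open B" "y0 \<in> B" "B \<subseteq> \<phi> ` U" using r by (auto simp: B_def)

  \<comment> \<open>As \<open>i\<close> is a topological embedding, no other part of \<open>S\<close> comes close to \<open>x0\<close>.\<close>
  obtain \<rho> where \<rho>: "\<rho> > 0" "\<And>x. x \<in> topspace M \<Longrightarrow> dist x0 (i x) < \<rho> \<Longrightarrow> x \<in> U \<and> \<phi> x \<in> B"
  proof -
    have "homeomorphic_map M (top_of_set S) i" using emb by (simp add: embedding_map_def S_def)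
    then have "openin (top_of_set S) (i ` {x \<in> U. \<phi> x \<in> B})"
      using is_chartD(5)[OF ch B(1)] homeomorphic_imp_open_map open_map_def by blast
    moreover have "x0 \<in> i ` {x \<in> U. \<phi> x \<in> B}" using q(2) U(2) B(2) by (auto simp: y0_def)
    ultimately obtain \<rho> where \<rho>: "\<rho> > 0" "ball x0 \<rho> \<inter> S \<subseteq> i ` {x \<in> U. \<phi> x \<in> B}"
      by (meson openin_contains_ball)
    show thesis
    proof (rule that[OF \<rho>(1)])
      fix x assume x: "x \<in> topspace M" "dist x0 (i x) < \<rho>"
      then obtain x' where "x' \<in> U" "\<phi> x' \<in> B" "i x = i x'"
        using \<rho>(2) by (auto simp: S_def)
      then show "x \<in> U \<and> \<phi> x \<in> B" using inj_onD[OF inj_i] x(1) U_sub by blast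
    qed
  qed
  have contF: "continuous_on B F"
    using smF B(3) continuous_on_subset unfolding smooth_on_def by (metis Ck_on.simps(1))
  obtain p :: "'n \<Rightarrow> real ^ 'n" and \<epsilon> where p: "0 < \<epsilon>" "\<epsilon> < \<rho>\<^sup>2 / 4"
    "\<And>j. p j \<in> F ` B" "\<And>j. (F y0 - p j) \<bullet> a = \<epsilon>"
    "\<And>w. (\<And>j k. (p j - p k) \<bullet> w = 0) \<Longrightarrow> \<exists>s. w = s *\<^sub>R a"
  proof (rule exists_spanning_slice[OF assms(3) B(1,2) contF \<open>linear L\<close> perp \<open>a \<noteq> 0\<close> \<pi>])
    show "inj_on (\<pi> \<circ> F) B" using r(3) by (simp add: B_def)
    show "(dist (F y0) (F y))\<^sup>2 \<le> 2 * ((F y0 - F y) \<bullet> a)" if "y \<in> B" for y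
      using cap[OF FS[OF subsetD[OF B(3) that]]] by (simp add: F0)
    show "0 < \<rho>\<^sup>2 / 4" using \<rho>(1) by simp
  qed blast+
  \<comment> \<open>Depth at most \<open>2 * \<epsilon>\<close> means distance at most \<open>2 * sqrt \<epsilon> < \<rho>\<close>, whence the bound on \<open>\<epsilon>\<close>.\<close>
  have near: "x \<in> U \<and> \<phi> x \<in> B" if "x \<in> topspace M" "(x0 - i x) \<bullet> a \<le> 2 * \<epsilon>" for x
  proof -
    have "(dist x0 (i x))\<^sup>2 \<le> 2 * ((x0 - i x) \<bullet> a)" using cap that(1) by (simp add: S_def)
    then have "(dist x0 (i x))\<^sup>2 < \<rho>\<^sup>2" using that(2) p(2) by simp
    then show ?thesis using \<rho> that(1) by (metis less_eq_real_def power2_less_imp_less)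
  qed

  have inj: "inj_on (distance_squared_mapping p \<circ> i) (topspace M)"
  proof (rule inj_onI)
    fix x x' assume x: "x \<in> topspace M" "x' \<in> topspace M"
      and eq: "(distance_squared_mapping p \<circ> i) x = (distance_squared_mapping p \<circ> i) x'"
    note D = distance_squared_mapping_eqD[OF eq[unfolded comp_apply]]
    obtain s where s: "i x - i x' = s *\<^sub>R a" using p(5) D(2) by blast
    show "x = x'"
    proof (cases "s = 0")
      case True
      then show ?thesis using s inj_i x by (auto simp: inj_on_def)
    next
      case False
      \<comment> \<open>The index is arbitrary, since all \<open>p j\<close> have depth \<open>\<epsilon>\<close>.\<close>
      have "(i x + i x' - 2 *\<^sub>R p undefined) \<bullet> a = 0"
        using D(1)[of undefined] False by (simp add: s)
      then have "(x0 - i x) \<bullet> a + (x0 - i x') \<bullet> a = 2 * \<epsilon>"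
        using p(4)[of undefined] by (simp add: F0 inner_diff inner_add)
      moreover have "(x0 - i x) \<bullet> a \<ge> 0" "(x0 - i x') \<bullet> a \<ge> 0"
        using cap x by (smt (verit) S_def imageI zero_le_power2)+
      ultimately have nx: "x \<in> U" "\<phi> x \<in> B" "x' \<in> U" "\<phi> x' \<in> B"
        using near x by auto
      have "\<pi> (i x) - \<pi> (i x') = 0" using \<pi>a s \<pi>(1) by (metis linear_diff)
      then have "(\<pi> \<circ> F) (\<phi> x) = (\<pi> \<circ> F) (\<phi> x')" using nx by (simp add: F\<phi>)
      then have "\<phi> x = \<phi> x'" using r(3) nx by (auto simp: B_def inj_on_def)
      then show ?thesis using is_chartD(3)[OF ch] nx by (auto simp: inj_on_def)
    qed
  qed

  have kernel: "inj (frechet_derivative ((distance_squared_mapping p \<circ> i) \<circ> inv_into V \<psi>) (at (\<psi> x)))"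
    if V: "(V, \<psi>) \<in> \<A>" "x \<in> V" for V \<psi> x
  proof -
    define K where "K = frechet_derivative (i \<circ> inv_into V \<psi>) (at (\<psi> x))"
    have chV: "is_chart M (V, \<psi>)" using man V(1) by (auto simp: smooth_manifold_def)
    have ix: "(i \<circ> inv_into V \<psi>) (\<psi> x) = i x" using is_chartD(3)[OF chV] V(2) by simp
    have xM: "x \<in> topspace M" using is_chartD(1)[OF chV] V(2) openin_subset by blast
    have K: "(i \<circ> inv_into V \<psi> has_derivative K) (at (\<psi> x))"
      unfolding K_def using smooth_map_has_derivative[OF sm V(1)] V(2) by simp
    have injK: "inj K" using imm V by (auto simp: immersion_def K_def)
    have linK: "linear K" using K by (simp add: has_derivative_bounded_linear bounded_linear.linear)
    have "(distance_squared_mapping p \<circ> (i \<circ> inv_into V \<psi>) has_derivative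
        (\<lambda>w. \<chi> j. 2 * ((i x - p j) \<bullet> w)) \<circ> K) (at (\<psi> x))"
      by (rule diff_chain_at[OF K]) (simp only: ix has_derivative_distance_squared_mapping)
    from frechet_derivative_at[OF this]
    have fd: "frechet_derivative ((distance_squared_mapping p \<circ> i) \<circ> inv_into V \<psi>) (at (\<psi> x))
        = (\<lambda>w. \<chi> j. 2 * ((i x - p j) \<bullet> w)) \<circ> K"
      by (simp add: comp_assoc)
    have "v = 0" if v: "((\<lambda>w. \<chi> j. 2 * ((i x - p j) \<bullet> w)) \<circ> K) v = 0" for v
    proof -
      have orth: "(i x - p j) \<bullet> K v = 0" for j
        using arg_cong[OF v, of "\<lambda>z. z $ j"] by simp
      have "(p j - p k) \<bullet> K v = 0" for j k
        using orth[of j] orth[of k] by (simp add: inner_diff)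
      then obtain s where s: "K v = s *\<^sub>R a" using p(5) by blast
      have "K v = 0"
      proof (cases "s = 0")
        case False
        \<comment> \<open>Then \<open>i x\<close> lies on the fold hyperplane, hence on the graph, and \<open>\<pi>\<close> is injective on
          the tangent space there but annihilates \<open>a\<close>.\<close>
        have "(i x - p undefined) \<bullet> a = 0" using orth[of undefined] s False by simp
        then have "(x0 - i x) \<bullet> a = \<epsilon>" using p(4)[of undefined] by (simp add: F0 inner_diff)
        then have nx: "x \<in> U" "\<phi> x \<in> B" using near[OF xM] p(1) by auto
        obtain u where u: "K v = frechet_derivative F (at (\<phi> x)) u"
          using range_derivative_chart_change[OF man sm U(1) nx(1) V] unfolding K_def F_def by blast
        have dg': "frechet_derivative (\<pi> \<circ> F) (at (\<phi> x)) = \<pi> \<circ> frechet_derivative F (at (\<phi> x))"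
          using dg nx(1) by blast
        have "linear (\<pi> \<circ> frechet_derivative F (at (\<phi> x)))"
          using derF nx(1) \<pi>(1) has_derivative_linear linear_compose by blast
        moreover have "inj (\<pi> \<circ> frechet_derivative F (at (\<phi> x)))"
          using r(4)[of "\<phi> x"] nx(2) unfolding B_def dg' .
        moreover have "(\<pi> \<circ> frechet_derivative F (at (\<phi> x))) u = 0"
          using \<pi>a[of s] by (simp add: u[symmetric] s)
        ultimately have "u = 0" by (metis linear_injective_0)
        then show ?thesis using u derF nx(1) has_derivative_linear linear_0 by (metis imageI)
      qed (use s in simp)
      then show "v = 0" using injK linK linear_injective_0 by blast
    qed
    moreover have "linear ((\<lambda>w. \<chi> j. 2 * ((i x - p j) \<bullet> w)) \<circ> K)"
      using linK has_derivative_distance_squared_mapping has_derivative_linear linear_compose by blast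
    ultimately show ?thesis unfolding fd using linear_injective_0 by blast
  qed

  have smD: "smooth_map \<A> (distance_squared_mapping p \<circ> i)"
    unfolding smooth_map_def
  proof (intro ballI, clarify)
    fix V \<psi> assume V: "(V, \<psi>) \<in> \<A>"
    have "open (\<psi> ` V)" using man V is_chartD(2) by (auto simp: smooth_manifold_def)
    moreover have "smooth_on (\<psi> ` V) (i \<circ> inv_into V \<psi>)" using sm V by (auto simp: smooth_map_def)
    ultimately have "smooth_on (\<psi> ` V) (\<lambda>y. distance_squared_mapping p ((i \<circ> inv_into V \<psi>) y))"
      by (rule smooth_on_distance_squared_mapping)
    then show "smooth_on (\<psi> ` V) (distance_squared_mapping p \<circ> i \<circ> inv_into V \<psi>)"
      by (simp add: o_def)
  qed

  have "continuous_map euclidean euclidean (distance_squared_mapping p)"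
    using has_derivative_continuous[OF has_derivative_distance_squared_mapping]
    by (auto intro: continuous_at_imp_continuous_on)
  then have "continuous_map M euclidean (distance_squared_mapping p \<circ> i)"
    using cont continuous_map_compose by blast
  then have "embedding_map M euclidean (distance_squared_mapping p \<circ> i)"
    by (rule continuous_imp_embedding_map[OF _ cpt _ inj]) simp
  moreover have "immersion \<A> (distance_squared_mapping p \<circ> i)"
    using smD kernel by (auto simp: immersion_def)
  moreover have "p j \<in> i ` topspace M" for j
    using p(3)[of j] FS B(3) by (auto simp: S_def)
  ultimately show ?thesis unfolding smooth_embedding_def by blast
qed

end
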